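(* Let $H$ be a complex Hilbert space of dimension at least $3$. Let $T, S: \underline{H} \to \underline{H}$ be bijective transformations with the property that \[ T\underline{x} \cdot S\underline{y} = \underline{x} \cdot \underline{y} \qquad (\underline{x}, \underline{y}\in \underline{H}). \] Then there are bounded invertible operators $U,V:H \to H$, either both linear or both conjugate-linear, such that $V={U^*}^{-1}$ and \[ T\underline{x} =\underline{Ux}, \qquad S\underline{x} =\underline{Vx} \qquad (x\in H). \]
   Context: For a vector $x\in H$, the ray associated to $x$ is the set $\underline{x}=\{\lambda x : \lambda\in\mathbb{C},\ |\lambda|=1\}$ (the zero vector is allowed, so $\underline{0}=\{0\}$). The set of all rays in $H$ is denoted $\underline{H}$. For $x,y\in H$ one defines $\underline{x}\cdot\underline{y}=|\langle x,y\rangle|$, which depends only on the rays. The inner product $\langle\cdot,\cdot\rangle$ is linear in the first variable and conjugate-linear in the second. For a bounded linear operator $U$, $U^*$ is the usual adjoint; for a bounded conjugate-linear operator $U$, $U^*$ is the bounded conjugate-linear operator determined by $\langle Ux,y\rangle=\overline{\langle x,U^*y\rangle}$ for all $x,y\in H$. ${U^*}^{-1}$ means $(U^* )^{-1}$. *)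

theory Defs
  imports "HOL-Analysis.Analysis"
begin

class complex_inner = real_normed_vector +
  fixes scaleC :: "complex \<Rightarrow> 'a \<Rightarrow> 'a" (infixr "*\<^sub>C" 75)
    and cinner :: "'a \<Rightarrow> 'a \<Rightarrow> complex"
  assumes scaleC_add_right: "c *\<^sub>C (x + y) = c *\<^sub>C x + c *\<^sub>C y"
    and scaleC_add_left: "(c + d) *\<^sub>C x = c *\<^sub>C x + d *\<^sub>C x"
    and scaleC_scaleC: "c *\<^sub>C (d *\<^sub>C x) = (c * d) *\<^sub>C x"
    and scaleC_of_real: "complex_of_real r *\<^sub>C x = r *\<^sub>R x"
    and cinner_commute: "cinner x y = cnj (cinner y x)"
    and cinner_add_left: "cinner (x + y) z = cinner x z + cinner y z"
    and cinner_scaleC_left: "cinner (c *\<^sub>C x) y = c * cinner x y"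
    and cinner_self: "cinner x x = complex_of_real ((norm x)\<^sup>2)"

class chilbert_space = complex_inner + complete_space

lemma scaleC_one: "1 *\<^sub>C (x::'a::complex_inner) = x"
  using scaleC_of_real[of 1 x] by simp

lemma vector_space_scaleC: "vector_space (scaleC :: complex \<Rightarrow> 'a \<Rightarrow> 'a::complex_inner)"
  by unfold_locales
    (simp_all add: scaleC_add_right scaleC_add_left scaleC_scaleC scaleC_one)

lemma cinner_scaleC_right: "cinner x (c *\<^sub>C y) = cnj c * cinner x y"
  by (metis cinner_commute cinner_scaleC_left complex_cnj_mult)

text \<open>The dimension is stated through independent sets because the library's
  \<open>dim\<close> is 0 on infinite-dimensional spaces.\<close>

definition cdim_at_least :: "nat \<Rightarrow> 'a::complex_inner itself \<Rightarrow> bool" where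
  "cdim_at_least n _ \<longleftrightarrow>
     (\<exists>B::'a set. finite B \<and> card B = n \<and> \<not> module.dependent (*\<^sub>C) B)"

definition ray :: "'a::complex_inner \<Rightarrow> 'a set" where
  "ray x = {c *\<^sub>C x |c. cmod c = 1}"

definition rays :: "'a::complex_inner set set" where
  "rays = range ray"

definition ray_prod :: "'a::complex_inner set \<Rightarrow> 'a set \<Rightarrow> real" where
  "ray_prod X Y = (THE r. \<exists>x y. X = ray x \<and> Y = ray y \<and> r = cmod (cinner x y))"

lemma ray_eqD:
  assumes "ray x = ray y"
  obtains c where "cmod c = 1" "x = c *\<^sub>C y"
proof -
  have "x \<in> ray x"
    unfolding ray_def using scaleC_one[of x] by (metis (mono_tags, lifting) mem_Collect_eq norm_one)
  then show thesis
    using assms that by (auto simp: ray_def)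
qed

lemma ray_prod_ray: "ray_prod (ray x) (ray y) = cmod (cinner x y)"
  unfolding ray_prod_def
proof (rule the_equality)
  fix r
  assume "\<exists>x' y'. ray x = ray x' \<and> ray y = ray y' \<and> r = cmod (cinner x' y')"
  then obtain x' y' where "ray x = ray x'" "ray y = ray y'" and r: "r = cmod (cinner x' y')"
    by blast
  then obtain c d where "cmod c = 1" "x = c *\<^sub>C x'" "cmod d = 1" "y = d *\<^sub>C y'"
    by (metis ray_eqD)
  then show "r = cmod (cinner x y)"
    by (simp add: r cinner_scaleC_left cinner_scaleC_right norm_mult)
qed blast

definition bounded_clinear :: "('a::complex_inner \<Rightarrow> 'a) \<Rightarrow> bool" where
  "bounded_clinear U \<longleftrightarrow> bounded_linear U \<and> (\<forall>c x. U (c *\<^sub>C x) = c *\<^sub>C U x)"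

definition bounded_antilinear :: "('a::complex_inner \<Rightarrow> 'a) \<Rightarrow> bool" where
  "bounded_antilinear U \<longleftrightarrow> bounded_linear U \<and> (\<forall>c x. U (c *\<^sub>C x) = cnj c *\<^sub>C U x)"

text \<open>The inverse of a bijective (conjugate-)linear map is automatically
  (conjugate-)linear, so only its boundedness is at issue.\<close>

definition boundedly_invertible :: "('a::complex_inner \<Rightarrow> 'a) \<Rightarrow> bool" where
  "boundedly_invertible U \<longleftrightarrow> bij U \<and> bounded_linear (inv U)"

definition cadjoint :: "('a::chilbert_space \<Rightarrow> 'a) \<Rightarrow> 'a \<Rightarrow> 'a" where
  "cadjoint U = (THE W. bounded_clinear W \<and> (\<forall>x y. cinner (U x) y = cinner x (W y)))"

definition antilinear_adjoint :: "('a::chilbert_space \<Rightarrow> 'a) \<Rightarrow> 'a \<Rightarrow> 'a" where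
  "antilinear_adjoint U =
     (THE W. bounded_antilinear W \<and> (\<forall>x y. cinner (U x) y = cnj (cinner x (W y))))"

end

theory Submission
  imports Defs
begin

text \<open>
  The proof runs along the lines of Wigner's theorem, with the second ray map supplying test vectors. Since \<open>S\<close> is
  onto, orthogonality against its values decides whether a vector lies in the span of two others,
  so \<open>T\<close> sends the ray of a combination \<open>a x + b y\<close> of independent vectors to the ray of a
  combination of representatives of the images of \<open>x\<close> and \<open>y\<close>; testing against vectors dual to
  \<open>x\<close> and \<open>y\<close> shows that the moduli of the two coefficients are kept (\<open>image_combination\<close>).

  What remains is to choose phases coherently. Fix \<open>e \<noteq> 0\<close> with image represented by \<open>e'\<close>. For
  \<open>y\<close> orthogonal to \<open>e\<close>, let \<open>L y\<close> be the representative of the image of \<open>y\<close> for which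
  \<open>e' + L y\<close> represents the image of \<open>e + y\<close>. Expanding the image of \<open>e + y + z\<close> in three ways
  shows that \<open>L\<close> is additive on independent pairs (\<open>L_add_cindep\<close>). On each line
  \<open>L (a y) = h(a) L y\<close>, and preservation of moduli makes \<open>h\<close> an isometry of the plane fixing \<open>0\<close>
  and \<open>1\<close>, that is, the identity or conjugation (\<open>L_homogeneous_single\<close>). Additivity forces the
  same alternative on all lines, the third dimension serving to compare parallel vectors
  (\<open>L_homogeneous\<close>). Extending \<open>L\<close> by \<open>e \<mapsto> e'\<close> gives a linear or conjugate-linear \<open>U\<close> that
  induces \<open>T\<close> (\<open>semilinear_lift\<close>).

  Given \<open>U\<close>, a representative of the image of \<open>y\<close> under \<open>S\<close> can be given the phase that makes
  \<open>\<langle>U x, V y\<rangle>\<close> equal to \<open>\<langle>x, y\<rangle>\<close>, or to its conjugate, for all \<open>x\<close> (\<open>dual_lift\<close>). Surjectivity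
  of \<open>U\<close> makes \<open>V\<close> semilinear, the uniform boundedness principle makes \<open>U\<close>, \<open>V\<close> and their inverses
  bounded (\<open>biadjoint_pair_bounded\<close>), and the identity itself says that the inverse of \<open>V\<close> is the
  adjoint of \<open>U\<close>.
\<close>

section \<open>Complex inner product spaces\<close>

interpretation cvec: vector_space "scaleC :: complex \<Rightarrow> 'a \<Rightarrow> 'a::complex_inner"
  by (rule vector_space_scaleC)

lemma cinner_add_right: "cinner x (y + z) = cinner x y + cinner (x::'a::complex_inner) z"
  by (metis cinner_add_left cinner_commute complex_cnj_add)

lemma cinner_zero_left [simp]: "cinner 0 (x::'a::complex_inner) = 0"
  using cinner_add_left[of 0 0 x] by simp

lemma cinner_zero_right [simp]: "cinner (x::'a::complex_inner) 0 = 0"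
  using cinner_add_right[of x 0 0] by simp

lemma cinner_diff_left: "cinner (x - y) z = cinner x z - cinner y (z::'a::complex_inner)"
  by (metis add_diff_cancel_right' cinner_add_left diff_add_cancel)

lemma cinner_diff_right: "cinner x (y - z) = cinner x y - cinner x (z::'a::complex_inner)"
  by (metis add_diff_cancel_right' cinner_add_right diff_add_cancel)

lemma cinner_scaleR_left: "cinner (r *\<^sub>R x) y = complex_of_real r * cinner x (y::'a::complex_inner)"
  by (metis cinner_scaleC_left scaleC_of_real)

lemma cinner_orth_commute: "cinner x y = 0 \<longleftrightarrow> cinner y (x::'a::complex_inner) = 0"
  by (metis cinner_commute complex_cnj_zero)

lemma cinner_self_eq_0 [simp]: "cinner x x = 0 \<longleftrightarrow> x = (0::'a::complex_inner)"
  by (simp add: cinner_self)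

lemma cinner_ext:
  assumes "\<And>z. cinner z x = cinner z (y::'a::complex_inner)"
  shows "x = y"
proof -
  have "cinner (x - y) (x - y) = 0"
    using assms[of "x - y"] by (simp add: cinner_diff_right)
  then show ?thesis by simp
qed

lemma orthogonal_decomposition:
  fixes x y :: "'a::complex_inner"
  obtains a p where "x = a *\<^sub>C y + p" "cinner p y = 0"
proof (cases "y = 0")
  case True
  then show ?thesis using that[of 0 x] by simp
next
  case False
  then show ?thesis
    using that[of "cinner x y / cinner y y" "x - (cinner x y / cinner y y) *\<^sub>C y"]
    by (simp add: cinner_diff_left cinner_scaleC_left)
qed

lemma cinner_Cauchy_Schwarz:
  fixes x y :: "'a::complex_inner"
  shows "cmod (cinner x y) \<le> norm x * norm y"
proof -
  obtain a p where x: "x = a *\<^sub>C y + p" and p: "cinner p y = 0"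
    by (rule orthogonal_decomposition)
  have p': "cinner y p = 0"
    using p cinner_orth_commute by blast
  have "cinner x x = (a * cnj a) * cinner y y + cinner p p"
    using p p' by (simp add: x cinner_add_left cinner_add_right cinner_scaleC_left cinner_scaleC_right)
  also have "\<dots> = complex_of_real ((cmod a)\<^sup>2 * (norm y)\<^sup>2 + (norm p)\<^sup>2)"
    by (simp only: cinner_self complex_norm_square of_real_mult of_real_add)
  finally have "(norm x)\<^sup>2 = (cmod a)\<^sup>2 * (norm y)\<^sup>2 + (norm p)\<^sup>2"
    by (simp only: cinner_self of_real_eq_iff)
  then have "(cmod a * norm y)\<^sup>2 \<le> (norm x)\<^sup>2"
    by (simp add: power_mult_distrib)
  then have "cmod a * norm y \<le> norm x"
    by (rule power2_le_imp_le) simp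
  moreover have "cmod (cinner x y) = cmod a * norm y * norm y"
    using p by (simp add: x cinner_add_left cinner_scaleC_left cinner_self norm_mult norm_power power2_eq_square)
  ultimately show ?thesis
    by (simp add: mult_right_mono)
qed

lemma bounded_linear_cinner_left: "bounded_linear (\<lambda>x. cinner x (y::'a::complex_inner))"
  by (rule bounded_linear_intro[of _ "norm y"])
    (simp_all add: cinner_add_left cinner_scaleR_left scaleR_conv_of_real cinner_Cauchy_Schwarz)

text \<open>The uniform boundedness principle for functionals \<open>\<lambda>z. cinner z v\<close>: by Baire, one of the closed
sets on which all of them are at most \<open>n\<close> contains a ball, and on a ball about \<open>z0\<close> the functional
of \<open>v\<close> varies by \<open>r * norm v\<close>.\<close>
lemma weakly_bounded_imp_bounded:
  fixes F :: "'a::chilbert_space set" and b :: "'a \<Rightarrow> real"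
  assumes b: "\<And>z v. v \<in> F \<Longrightarrow> cmod (cinner z v) \<le> b z"
  obtains K where "\<And>v. v \<in> F \<Longrightarrow> norm v \<le> K"
proof -
  define A where "A n = {z. \<forall>v\<in>F. cmod (cinner z v) \<le> real n}" for n
  have closed: "closed (A n)" for n
  proof -
    have "A n = (\<Inter>v\<in>F. {z. cmod (cinner z v) \<le> real n})"
      by (auto simp: A_def)
    moreover have "closed {z. cmod (cinner z v) \<le> real n}" for v
      by (intro closed_Collect_le continuous_intros
          linear_continuous_on[OF bounded_linear_cinner_left])
    ultimately show ?thesis by auto
  qed
  have "(\<Union>n. A n) = UNIV"
  proof -
    have "z \<in> (\<Union>n. A n)" for z
    proof -
      obtain n where "b z \<le> real n" using real_arch_simple by blast
      then have "z \<in> A n" unfolding A_def using b order_trans by blast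
      then show ?thesis by blast
    qed
    then show ?thesis by blast
  qed
  moreover have "interior (\<Union>n. A n) = {}" if "\<And>n. interior (A n) = {}"
    using Met_TC.metric_Baire_category_alt[of "range A"] that closed
    by (auto simp: complete_UNIV)
  ultimately obtain n z0 where "z0 \<in> interior (A n)"
    by fastforce
  then obtain r where r: "r > 0" "cball z0 r \<subseteq> A n"
    by (meson mem_interior_cball)
  have "norm v \<le> 2 * real n / r" if v: "v \<in> F" for v
  proof (cases "v = 0")
    case True
    then show ?thesis using r by simp
  next
    case False
    define z where "z = z0 + (r / norm v) *\<^sub>R v"
    have "z0 \<in> A n" "z \<in> A n"
      using r False by (auto simp: z_def dist_norm intro!: subsetD[OF r(2)])
    then have "cmod (cinner z0 v) \<le> n" "cmod (cinner z v) \<le> n"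
      using v by (auto simp: A_def)
    moreover have "cinner z v - cinner z0 v = complex_of_real (r * norm v)"
      using False by (simp add: z_def cinner_add_left cinner_scaleR_left cinner_self power2_eq_square)
    then have "cmod (cinner z v - cinner z0 v) = r * norm v"
      using r by (simp add: norm_mult)
    ultimately have "r * norm v \<le> 2 * real n"
      using norm_triangle_ineq4[of "cinner z v" "cinner z0 v"] by linarith
    then show ?thesis using r by (simp add: field_simps)
  qed
  then show thesis by (rule that)
qed

text \<open>Membership in a span expressed by orthogonality alone, the only relation that a pair of dual ray
maps visibly respects. The part \<open>w\<close> of \<open>x\<close> orthogonal to both vectors, found by two
Gram-Schmidt steps, is orthogonal to \<open>x\<close> by hypothesis and hence to itself.\<close>
lemma in_span_pair_if_annihilated:
  fixes x y z :: "'a::complex_inner"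
  assumes ann: "\<And>w. cinner y w = 0 \<Longrightarrow> cinner z w = 0 \<Longrightarrow> cinner x w = 0"
  obtains a b where "x = a *\<^sub>C y + b *\<^sub>C z"
proof -
  obtain a z1 where z: "z = a *\<^sub>C y + z1" and z1: "cinner z1 y = 0"
    by (rule orthogonal_decomposition)
  obtain b x1 where x: "x = b *\<^sub>C y + x1" and x1: "cinner x1 y = 0"
    by (rule orthogonal_decomposition)
  obtain c w where x1': "x1 = c *\<^sub>C z1 + w" and w: "cinner w z1 = 0"
    by (rule orthogonal_decomposition)
  have wy: "cinner w y = 0"
    using x1 z1 by (simp add: x1' cinner_add_left cinner_scaleC_left)
  have orth: "cinner y w = 0" "cinner z1 w = 0"
    using wy w cinner_orth_commute by blast+
  then have "cinner x w = 0"
    by (intro ann) (simp_all add: z cinner_add_left cinner_scaleC_left)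
  then have "w = 0"
    using orth by (simp add: x x1' cinner_add_left cinner_scaleC_left)
  then have "x = (b - c * a) *\<^sub>C y + c *\<^sub>C z"
    by (simp add: x x1' z algebra_simps)
  then show thesis by (rule that)
qed

text \<open>Linear independence of the family \<open>x, y\<close>; unlike independence of the set \<open>{x, y}\<close>, it fails
when \<open>x = y\<close>.\<close>
definition cindep :: "'a::complex_inner \<Rightarrow> 'a \<Rightarrow> bool" where
  "cindep x y \<longleftrightarrow> (\<forall>a b. a *\<^sub>C x + b *\<^sub>C y = 0 \<longrightarrow> a = 0 \<and> b = 0)"

lemma cindepD: "cindep x y \<Longrightarrow> a *\<^sub>C x + b *\<^sub>C y = 0 \<Longrightarrow> a = 0 \<and> b = 0"
  by (auto simp: cindep_def)

lemma cindep_eqD: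
  assumes "cindep x y" "a *\<^sub>C x + b *\<^sub>C y = c *\<^sub>C x + d *\<^sub>C y"
  shows "a = c" "b = d"
  using cindepD[OF assms(1), of "a - c" "b - d"] assms(2) by (auto simp: algebra_simps)

lemma cindep_sym: "cindep x y \<Longrightarrow> cindep y x"
  by (metis add.commute cindep_def)

lemma cindep_nonzero: "cindep x y \<Longrightarrow> x \<noteq> 0"
  using cindepD[of x y 1 0] by auto

lemma cindep_or_multiple:
  assumes "(x::'a::complex_inner) \<noteq> 0"
  obtains "cindep x y" | c where "y = c *\<^sub>C x"
proof (cases "cindep x y")
  case False
  then obtain a b where ab: "a *\<^sub>C x + b *\<^sub>C y = 0" "a \<noteq> 0 \<or> b \<noteq> 0"
    by (auto simp: cindep_def)
  have "b \<noteq> 0" using ab assms by auto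
  have "y = (- a / b) *\<^sub>C x"
  proof -
    have "b *\<^sub>C y = (- a) *\<^sub>C x"
      using ab(1) by (simp add: add_eq_0_iff2 add.commute)
    then have "inverse b *\<^sub>C (b *\<^sub>C y) = inverse b *\<^sub>C ((- a) *\<^sub>C x)"
      by simp
    then show ?thesis using \<open>b \<noteq> 0\<close> by (simp add: divide_inverse mult.commute)
  qed
  then show ?thesis by (rule that(2))
qed (rule that(1))

lemma cindep_dual_vector:
  assumes "cindep x y"
  obtains w where "cinner y w = 0" "cinner x w \<noteq> 0"
proof -
  obtain a p where x: "x = a *\<^sub>C y + p" and p: "cinner p y = 0"
    by (rule orthogonal_decomposition)
  have yp: "cinner y p = 0" using p cinner_orth_commute by blast
  have "p \<noteq> 0"
    using cindepD[OF assms, of 1 "- a"] x by auto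
  then have "cinner x p \<noteq> 0"
    using yp by (simp add: x cinner_add_left cinner_scaleC_left)
  with yp show thesis by (rule that)
qed

lemma exists_orthogonal_cindep:
  fixes e y :: "'a::complex_inner"
  assumes dim: "cdim_at_least 3 TYPE('a)" and e: "e \<noteq> 0" and y: "y \<noteq> 0" "cinner y e = 0"
  obtains w where "cinner w e = 0" "cindep y w"
proof -
  obtain B :: "'a set" where B: "card B = 3" "\<not> cvec.dependent B"
    using dim by (auto simp: cdim_at_least_def)
  have "card {e, y} \<le> 2" by (simp add: card_insert_if)
  then have "\<not> B \<subseteq> cvec.span {e, y}"
    using cvec.independent_span_bound[of "{e, y}" B] B by auto
  then obtain x where x: "x \<notin> cvec.span {e, y}" by blast
  obtain a w where xw: "x = a *\<^sub>C e + w" and w: "cinner w e = 0"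
    by (rule orthogonal_decomposition)
  have "cindep y w"
    using y(1)
  proof (cases rule: cindep_or_multiple[of y w])
    case (2 c)
    have "x \<in> cvec.span {e, y}"
      unfolding xw 2 by (intro cvec.span_add cvec.span_scale cvec.span_base) auto
    with x show ?thesis by blast
  qed
  with w show thesis by (rule that)
qed

text \<open>The distances to \<open>0\<close> and \<open>1\<close> determine the real part of \<open>h a\<close>; those to \<open>0\<close> and \<open>\<i>\<close>
then show that the sign of the imaginary part is decided by \<open>h \<i>\<close> for all points at once.\<close>
lemma complex_isometry_fixing_0_1:
  fixes h :: "complex \<Rightarrow> complex"
  assumes iso: "\<And>a b. cmod (h a - h b) = cmod (a - b)" and h0: "h 0 = 0" and h1: "h 1 = 1"
  shows "h = id \<or> h = cnj"
proof -
  have sq: "(Re (h a) - Re (h b))\<^sup>2 + (Im (h a) - Im (h b))\<^sup>2 = (Re a - Re b)\<^sup>2 + (Im a - Im b)\<^sup>2"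
    for a b
    using iso[of a b] by (metis cmod_power2 minus_complex.sel)
  have re: "Re (h a) = Re a" for a
    using sq[of a 0] sq[of a 1] by (simp add: h0 h1 power2_eq_square algebra_simps)
  have im: "Im (h a) = Im a * Im (h \<i>)" for a
    using sq[of a 0] sq[of a \<i>] sq[of \<i> 0] by (simp add: h0 re power2_eq_square algebra_simps)
  have "(Im (h \<i>))\<^sup>2 = 1"
    using sq[of \<i> 0] by (simp add: h0 re)
  then have "Im (h \<i>) = 1 \<or> Im (h \<i>) = -1"
    by (simp add: power2_eq_1_iff)
  then show ?thesis
  proof
    assume i: "Im (h \<i>) = 1"
    have "h a = a" for a
      by (rule complex_eqI) (simp_all add: re im[of a] i)
    then show ?thesis by auto
  next
    assume i: "Im (h \<i>) = -1"
    have "h a = cnj a" for a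
      by (rule complex_eqI) (simp_all add: re im[of a] i)
    then show ?thesis by auto
  qed
qed

lemma mem_ray: "x \<in> ray (x::'a::complex_inner)"
  unfolding ray_def using scaleC_one[of x] by (metis (mono_tags, lifting) mem_Collect_eq norm_one)

lemma ray_scale_cong:
  assumes "cmod a = cmod b"
  shows "ray (a *\<^sub>C x) = ray (b *\<^sub>C (x::'a::complex_inner))"
proof -
  have sub: "ray (a *\<^sub>C x) \<subseteq> ray (b *\<^sub>C x)" if "cmod a = cmod b" for a b
  proof
    fix y assume "y \<in> ray (a *\<^sub>C x)"
    then obtain c where c: "cmod c = 1" "y = (c * a) *\<^sub>C x" by (auto simp: ray_def)
    show "y \<in> ray (b *\<^sub>C x)"
    proof (cases "b = 0")
      case True
      then show ?thesis using c that mem_ray[of 0] by auto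
    next
      case False
      then have "y = (c * a / b) *\<^sub>C (b *\<^sub>C x)" "cmod (c * a / b) = 1"
        using c that by (auto simp: norm_mult norm_divide)
      then show ?thesis unfolding ray_def by blast
    qed
  qed
  show ?thesis using sub[OF assms] sub[OF assms[symmetric]] by blast
qed

lemma ray_phase: "cmod c = 1 \<Longrightarrow> ray (c *\<^sub>C x) = ray (x::'a::complex_inner)"
  using ray_scale_cong[of c 1 x] by simp

section \<open>Pairs of dual ray transformations\<close>

locale ray_duality =
  fixes T S :: "'a::complex_inner set \<Rightarrow> 'a set"
  assumes T_bij: "bij_betw T rays rays"
    and S_bij: "bij_betw S rays rays"
    and dual: "\<And>X Y. X \<in> rays \<Longrightarrow> Y \<in> rays \<Longrightarrow> ray_prod (T X) (S Y) = ray_prod X Y"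
begin

lemma T_ray_ex: obtains u where "T (ray x) = ray u"
proof -
  have "T (ray x) \<in> rays"
    using bij_betwE[OF T_bij] by (simp add: rays_def)
  then show thesis using that by (auto simp: rays_def)
qed

lemma S_ray_ex: obtains u where "S (ray x) = ray u"
proof -
  have "S (ray x) \<in> rays"
    using bij_betwE[OF S_bij] by (simp add: rays_def)
  then show thesis using that by (auto simp: rays_def)
qed

lemma T_ray_onto: obtains x where "T (ray x) = ray u"
proof -
  have "ray u \<in> T ` rays"
    using bij_betw_imp_surj_on[OF T_bij] by (simp add: rays_def)
  then show thesis using that by (auto simp: rays_def)
qed

lemma S_ray_onto: obtains x where "S (ray x) = ray u"
proof -
  have "ray u \<in> S ` rays"
    using bij_betw_imp_surj_on[OF S_bij] by (simp add: rays_def)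
  then show thesis using that by (auto simp: rays_def)
qed

lemma modulus:
  assumes "T (ray x) = ray u" "S (ray w) = ray v"
  shows "cmod (cinner u v) = cmod (cinner x w)"
  using dual[of "ray x" "ray w"] assms by (simp add: rays_def ray_prod_ray)

lemma orthogonality:
  assumes "T (ray x) = ray u" "S (ray w) = ray v"
  shows "cinner u v = 0 \<longleftrightarrow> cinner x w = 0"
  using modulus[OF assms] by (metis norm_eq_zero)

lemma T_zero: "T (ray x) = ray u \<Longrightarrow> u = 0 \<longleftrightarrow> x = 0"
proof -
  assume u: "T (ray x) = ray u"
  obtain v where v: "S (ray x) = ray v" by (rule S_ray_ex)
  obtain w where w: "S (ray w) = ray u" by (rule S_ray_onto)
  show ?thesis
    using orthogonality[OF u v] orthogonality[OF u w] by auto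
qed

text \<open>Every vector is, up to phase, a value of \<open>S\<close>, so vectors orthogonal to \<open>u\<close> and \<open>v\<close> come
from vectors orthogonal to \<open>x\<close> and \<open>y\<close>.\<close>
lemma image_in_span:
  assumes x: "T (ray x) = ray u" and y: "T (ray y) = ray v"
    and t: "T (ray (a *\<^sub>C x + b *\<^sub>C y)) = ray t"
  obtains a' b' where "t = a' *\<^sub>C u + b' *\<^sub>C v"
proof (rule in_span_pair_if_annihilated)
  fix w assume w: "cinner u w = 0" "cinner v w = 0"
  obtain w0 where w0: "S (ray w0) = ray w" by (rule S_ray_onto)
  have "cinner x w0 = 0" "cinner y w0 = 0"
    using w orthogonality[OF x w0] orthogonality[OF y w0] by simp_all
  then show "cinner t w = 0"
    using orthogonality[OF t w0] by (simp add: cinner_add_left cinner_scaleC_left)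
qed (rule that)

lemma image_cindep:
  assumes x: "T (ray x) = ray u" and y: "T (ray y) = ray v" and ind: "cindep x y"
  shows "cindep u v"
proof -
  have left: "a = 0"
    if x: "T (ray x) = ray u" and y: "T (ray y) = ray v" and ind: "cindep x y"
      and ab: "a *\<^sub>C u + b *\<^sub>C v = 0" for x y u v a b
  proof -
    obtain w where w: "cinner y w = 0" "cinner x w \<noteq> 0"
      using ind by (rule cindep_dual_vector)
    obtain w' where w': "S (ray w) = ray w'" by (rule S_ray_ex)
    have "a * cinner u w' + b * cinner v w' = 0"
      using ab by (metis cinner_add_left cinner_scaleC_left cinner_zero_left)
    then show ?thesis
      using orthogonality[OF x w'] orthogonality[OF y w'] w by simp
  qed
  show ?thesis
    unfolding cindep_def using left[OF x y ind] left[OF y x cindep_sym[OF ind]]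
    by (metis add.commute)
qed

text \<open>Testing against the image under \<open>S\<close> of a vector orthogonal to \<open>y\<close> but not to \<open>x\<close> isolates
the coefficient of \<open>u\<close>. Only the moduli are determined here; the phases depend on the choice of
representatives and are tied together below.\<close>
lemma image_combination:
  assumes x: "T (ray x) = ray u" and y: "T (ray y) = ray v" and ind: "cindep x y"
    and t: "T (ray (a *\<^sub>C x + b *\<^sub>C y)) = ray t"
  obtains a' b' where "t = a' *\<^sub>C u + b' *\<^sub>C v" "cmod a' = cmod a" "cmod b' = cmod b"
proof -
  have left: "cmod a' = cmod a"
    if x: "T (ray x) = ray u" and y: "T (ray y) = ray v" and ind: "cindep x y"
      and t: "T (ray (a *\<^sub>C x + b *\<^sub>C y)) = ray t" "t = a' *\<^sub>C u + b' *\<^sub>C v"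
    for x y u v a b a' b'
  proof -
    obtain w where w: "cinner y w = 0" "cinner x w \<noteq> 0"
      using ind by (rule cindep_dual_vector)
    obtain w' where w': "S (ray w) = ray w'" by (rule S_ray_ex)
    have "cinner v w' = 0"
      using orthogonality[OF y w'] w by simp
    then have "cmod a' * cmod (cinner u w') = cmod a * cmod (cinner x w)"
      using modulus[OF t(1) w'] w
      by (simp add: t(2) cinner_add_left cinner_scaleC_left norm_mult)
    then show ?thesis
      using modulus[OF x w'] w by simp
  qed
  obtain a' b' where eq: "t = a' *\<^sub>C u + b' *\<^sub>C v"
    by (rule image_in_span[OF x y t])
  show thesis
  proof (rule that[OF eq])
    show "cmod a' = cmod a" by (rule left[OF x y ind t eq])
    show "cmod b' = cmod b"
      by (rule left[OF y x cindep_sym[OF ind], where b = a and b' = a'])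
        (use t eq in \<open>simp_all add: add.commute\<close>)
  qed
qed

lemma image_scale:
  assumes x: "T (ray x) = ray u" and "cmod b = cmod a"
  shows "T (ray (a *\<^sub>C x)) = ray (b *\<^sub>C u)"
proof (cases "x = 0")
  case True
  then have "u = 0" using T_zero[OF x] by blast
  then show ?thesis using x True by simp
next
  case False
  obtain t where t: "T (ray (a *\<^sub>C x)) = ray t" by (rule T_ray_ex)
  obtain c d where "t = c *\<^sub>C u + d *\<^sub>C u"
    by (rule image_in_span[OF x x, of a 0 t]) (use t in simp)
  then have cd: "t = (c + d) *\<^sub>C u" by (simp add: cvec.scale_left_distrib)
  obtain v where v: "S (ray x) = ray v" by (rule S_ray_ex)
  have "cmod (c + d) * cmod (cinner u v) = cmod a * cmod (cinner x x)"
    using modulus[OF t v] by (simp add: cd cinner_scaleC_left norm_mult)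
  then have "cmod (c + d) = cmod a"
    using modulus[OF x v] False by simp
  then show ?thesis
    using t cd ray_scale_cong[of "c + d" b u] assms by simp
qed

end

section \<open>Choosing phases relative to an anchor\<close>

text \<open>For \<open>y\<close> orthogonal to a fixed \<open>e\<close>, the representative \<open>L y\<close> of the image of its ray is normalised by
requiring that \<open>e' + L y\<close> represent the image of the ray of \<open>e + y\<close>. This determines \<open>L y\<close>, and
\<open>L\<close> turns out to be semilinear on the orthogonal complement of \<open>e\<close>.\<close>
locale anchored_ray_duality = ray_duality T S
  for T S :: "'a::complex_inner set \<Rightarrow> 'a set" +
  fixes e e' :: 'a and L :: "'a \<Rightarrow> 'a"
  assumes e: "e \<noteq> 0" and T_e: "T (ray e) = ray e'"
    and L: "\<And>y. cinner y e = 0 \<Longrightarrow> T (ray y) = ray (L y)"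
    and L_anchor: "\<And>y. cinner y e = 0 \<Longrightarrow> T (ray (e + y)) = ray (e' + L y)"
begin

lemma L_zero: "L 0 = 0"
  using T_zero[OF L[of 0]] by simp

text \<open>The image under \<open>S\<close> of \<open>e\<close> itself is orthogonal to the values of \<open>L\<close>, hence it reads off the
coefficient of \<open>e'\<close>.\<close>
lemma anchor_coefficient:
  assumes y: "cinner y e = 0" and z: "cinner z e = 0"
    and eq: "a *\<^sub>C e' + b *\<^sub>C L y + c *\<^sub>C L z = 0"
  shows "a = 0"
proof -
  obtain v where v: "S (ray e) = ray v" by (rule S_ray_ex)
  have "cinner (L y) v = 0" "cinner (L z) v = 0" "cinner e' v \<noteq> 0"
    using orthogonality[OF L[OF y] v] orthogonality[OF L[OF z] v] orthogonality[OF T_e v] y z e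
    by auto
  moreover have "a * cinner e' v + b * cinner (L y) v + c * cinner (L z) v = 0"
    using eq by (metis cinner_add_left cinner_scaleC_left cinner_zero_left)
  ultimately show ?thesis by simp
qed

lemma anchor_coefficients:
  assumes y: "cinner y e = 0" and z: "cinner z e = 0" and ind: "cindep y z"
    and eq: "a *\<^sub>C e' + b *\<^sub>C L y + c *\<^sub>C L z = a' *\<^sub>C e' + b' *\<^sub>C L y + c' *\<^sub>C L z"
  shows "a = a'" "b = b'" "c = c'"
proof -
  have "(a - a') *\<^sub>C e' + (b - b') *\<^sub>C L y + (c - c') *\<^sub>C L z = 0"
    using eq by (simp add: algebra_simps)
  then show a: "a = a'"
    using anchor_coefficient[OF y z] by fastforce
  have "cindep (L y) (L z)"
    by (rule image_cindep[OF L[OF y] L[OF z] ind])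
  then show "b = b'" "c = c'"
    using cindep_eqD[of "L y" "L z" b c b' c'] eq a by (auto simp: add.assoc)
qed

text \<open>A representative \<open>t\<close> of the image of \<open>e + y + z\<close> can be expanded along the three groupings
\<open>(e + y) + z\<close>, \<open>(e + z) + y\<close> and \<open>e + (y + z)\<close>. Comparing coefficients with respect to the
independent vectors \<open>e'\<close>, \<open>L y\<close>, \<open>L z\<close> forces all phases to agree.\<close>
lemma L_add_cindep:
  assumes y: "cinner y e = 0" and z: "cinner z e = 0" and ind: "cindep y z"
  shows "L (y + z) = L y + L z"
proof -
  have ind_anchor: "cindep (e + x) w"
    if x: "cinner x e = 0" and w: "cinner w e = 0" "w \<noteq> 0" for x w
    unfolding cindep_def
  proof (intro allI impI)
    fix a b assume eq: "a *\<^sub>C (e + x) + b *\<^sub>C w = 0"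
    have "a * (cinner e e + cinner x e) + b * cinner w e = cinner (a *\<^sub>C (e + x) + b *\<^sub>C w) e"
      by (simp only: cinner_add_left cinner_scaleC_left)
    then have "a = 0"
      using eq x w e by simp
    then show "a = 0 \<and> b = 0" using eq w by simp
  qed
  have yz: "cinner (y + z) e = 0" using y z by (simp add: cinner_add_left)
  obtain t where t: "T (ray (e + y + z)) = ray t" by (rule T_ray_ex)
  obtain p q where pq: "t = p *\<^sub>C (e' + L y) + q *\<^sub>C L z" "cmod p = 1"
    by (rule image_combination[OF L_anchor[OF y] L[OF z] ind_anchor, of 1 1 t])
      (use t y z cindep_nonzero[OF cindep_sym[OF ind]] in auto)
  obtain p' q' where pq': "t = p' *\<^sub>C (e' + L z) + q' *\<^sub>C L y"
    by (rule image_combination[OF L_anchor[OF z] L[OF y] ind_anchor, of 1 1 t])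
      (use t y z cindep_nonzero[OF ind] in \<open>auto simp: ac_simps\<close>)
  have "ray t = ray (e' + L (y + z))"
    using t L_anchor[OF yz] by (simp add: add.assoc)
  then obtain r where r: "t = r *\<^sub>C (e' + L (y + z))"
    by (rule ray_eqD)
  obtain a b where ab: "L (y + z) = a *\<^sub>C L y + b *\<^sub>C L z"
    by (rule image_in_span[OF L[OF y] L[OF z], of 1 1 "L (y + z)"]) (use L[OF yz] in auto)
  note uniq = anchor_coefficients[OF y z ind]
  have "p *\<^sub>C e' + p *\<^sub>C L y + q *\<^sub>C L z = p' *\<^sub>C e' + q' *\<^sub>C L y + p' *\<^sub>C L z"
    using pq(1) pq' by (simp add: algebra_simps)
  then have 1: "p = p'" "q = p'" using uniq by blast+
  have "p *\<^sub>C e' + p *\<^sub>C L y + q *\<^sub>C L z = r *\<^sub>C e' + (r * a) *\<^sub>C L y + (r * b) *\<^sub>C L z"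
    using pq(1) r by (simp add: ab algebra_simps)
  then have "p = r" "p = r * a" "q = r * b" using uniq by blast+
  moreover have "p \<noteq> 0" using pq(2) by auto
  ultimately have "a = 1" "b = 1" using 1 by auto
  then show ?thesis by (simp add: ab)
qed

text \<open>Testing \<open>e' + L (a *\<^sub>C y)\<close> against the image of a vector orthogonal to \<open>e + b *\<^sub>C y\<close> turns the
preservation of moduli into \<open>cmod (h a - h b) = cmod (a - b)\<close>, so no wild automorphism of the
complex field can appear.\<close>
lemma L_homogeneous_single:
  assumes y: "cinner y e = 0" "y \<noteq> 0"
  obtains h where "h = id \<or> h = cnj" "\<And>a. L (a *\<^sub>C y) = h a *\<^sub>C L y"
proof -
  have orth: "cinner (a *\<^sub>C y) e = 0" for a using y by (simp add: cinner_scaleC_left)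
  have "\<exists>b. L (a *\<^sub>C y) = b *\<^sub>C L y" for a
    by (rule image_in_span[OF L[OF y(1)] L[OF y(1)], of a 0 "L (a *\<^sub>C y)"])
      (use L[OF orth] in \<open>auto simp flip: cvec.scale_left_distrib\<close>)
  then obtain h where h: "\<And>a. L (a *\<^sub>C y) = h a *\<^sub>C L y" by metis
  have Ly: "L y \<noteq> 0" using T_zero[OF L] y by blast
  have "h 0 = 0" using h[of 0] L_zero Ly by simp
  moreover have "h 1 = 1"
    using h[of 1] Ly by (metis cvec.scale_cancel_right cvec.scale_one)
  moreover have "cmod (h a - h b) = cmod (a - b)" for a b
  proof -
    \<comment> \<open>orthogonal to \<open>e + b *\<^sub>C y\<close>\<close>
    define w where "w = cnj (b * cinner y y / cinner e e) *\<^sub>C e - y"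
    obtain w' where w': "S (ray w) = ray w'" by (rule S_ray_ex)
    have ey: "cinner e y = 0" using y cinner_orth_commute by blast
    have val: "cinner (e + c *\<^sub>C y) w = (b - c) * cinner y y" for c
      using y ey e by (simp add: w_def cinner_diff_right cinner_add_left cinner_scaleC_left
        cinner_scaleC_right left_diff_distrib)
    have yw: "cmod (cinner (L y) w') = cmod (cinner y y)"
      using modulus[OF L[OF y(1)] w'] y by (simp add: w_def cinner_diff_right cinner_scaleC_right)
    have "cinner (e' + h b *\<^sub>C L y) w' = 0"
      using orthogonality[OF L_anchor[OF orth] w', of b] val[of b] by (simp add: h)
    then have "cinner (e' + h a *\<^sub>C L y) w' = (h a - h b) * cinner (L y) w'"
      by (simp add: cinner_add_left cinner_scaleC_left algebra_simps)
    moreover have "cmod (cinner (e' + h a *\<^sub>C L y) w') = cmod (b - a) * cmod (cinner y y)"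
      using modulus[OF L_anchor[OF orth] w', of a] val[of a] by (simp add: h norm_mult)
    ultimately show ?thesis
      using yw y by (simp add: norm_mult norm_minus_commute)
  qed
  ultimately have "h = id \<or> h = cnj"
    by (intro complex_isometry_fixing_0_1)
  then show thesis using h by (rule that)
qed

text \<open>For independent \<open>y\<close> and \<open>z\<close>, additivity applied to \<open>\<i> *\<^sub>C (y + z)\<close> shows that both have the same
scalar map. Two parallel vectors are compared through a third direction orthogonal to \<open>e\<close>, which
exists because the dimension is at least three.\<close>
lemma L_homogeneous:
  assumes dim: "cdim_at_least 3 TYPE('a)"
  obtains k where "k = id \<or> k = cnj" "\<And>a y. cinner y e = 0 \<Longrightarrow> L (a *\<^sub>C y) = k a *\<^sub>C L y"
proof -
  obtain H where H: "\<And>y. cinner y e = 0 \<Longrightarrow> y \<noteq> 0 \<Longrightarrow> H y = id \<or> H y = cnj"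
      "\<And>y a. cinner y e = 0 \<Longrightarrow> y \<noteq> 0 \<Longrightarrow> L (a *\<^sub>C y) = H y a *\<^sub>C L y"
  proof -
    have "\<forall>y. \<exists>h. cinner y e = 0 \<longrightarrow> y \<noteq> 0 \<longrightarrow>
        (h = id \<or> h = cnj) \<and> (\<forall>a. L (a *\<^sub>C y) = h a *\<^sub>C L y)"
      using L_homogeneous_single by metis
    then show thesis using that by metis
  qed
  have ind: "H y = H z" if y: "cinner y e = 0" and z: "cinner z e = 0" and yz: "cindep y z" for y z
  proof -
    have nz: "y \<noteq> 0" "z \<noteq> 0" "y + z \<noteq> 0"
      using cindep_nonzero yz cindep_sym[OF yz] cindepD[OF yz, of 1 1] by auto
    have o: "cinner (y + z) e = 0" "cinner (\<i> *\<^sub>C y) e = 0" "cinner (\<i> *\<^sub>C z) e = 0"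
      using y z by (simp_all add: cinner_add_left cinner_scaleC_left)
    have "cindep (\<i> *\<^sub>C y) (\<i> *\<^sub>C z)"
      unfolding cindep_def using cindepD[OF yz] by (simp add: cvec.scale_scale) (metis complex_i_not_zero mult_eq_0_iff)
    then have "L (\<i> *\<^sub>C (y + z)) = L (\<i> *\<^sub>C y) + L (\<i> *\<^sub>C z)"
      using L_add_cindep[OF o(2,3)] by (simp add: cvec.scale_right_distrib)
    moreover have "L (\<i> *\<^sub>C (y + z)) = H (y + z) \<i> *\<^sub>C L y + H (y + z) \<i> *\<^sub>C L z"
      using H(2)[OF o(1) nz(3)] L_add_cindep[OF y z yz] by (simp add: cvec.scale_right_distrib)
    ultimately have "H (y + z) \<i> *\<^sub>C L y + H (y + z) \<i> *\<^sub>C L z = H y \<i> *\<^sub>C L y + H z \<i> *\<^sub>C L z"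
      using H(2) y z nz by simp
    from cindep_eqD[OF image_cindep[OF L[OF y] L[OF z] yz] this]
    have "H y \<i> = H z \<i>" by simp
    then show ?thesis using H(1)[OF y nz(1)] H(1)[OF z nz(2)] by (auto simp: complex_eq_iff)
  qed
  have all: "H y = H z" if y: "cinner y e = 0" "y \<noteq> 0" and z: "cinner z e = 0" "z \<noteq> 0" for y z
    using y(2)
  proof (cases rule: cindep_or_multiple[of y z])
    case 1
    then show ?thesis using ind y z by blast
  next
    case (2 c)
    obtain w where w: "cinner w e = 0" "cindep y w"
      by (rule exists_orthogonal_cindep[OF dim e y(2,1)])
    have "c \<noteq> 0" using 2 z by auto
    have "cindep z w"
      unfolding cindep_def
    proof (intro allI impI)
      fix a b assume "a *\<^sub>C z + b *\<^sub>C w = 0"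
      then show "a = 0 \<and> b = 0"
        using cindepD[OF w(2), of "a * c" b] \<open>c \<noteq> 0\<close> by (simp add: 2)
    qed
    then show ?thesis using ind[OF y(1) w] ind[OF z(1) w(1)] by simp
  qed
  show thesis
  proof (cases "\<exists>y0. cinner y0 e = 0 \<and> y0 \<noteq> 0")
    case True
    then obtain y0 where y0: "cinner y0 e = 0" "y0 \<noteq> 0" by blast
    show thesis
    proof (rule that)
      show "H y0 = id \<or> H y0 = cnj" using H(1) y0 by blast
      show "L (a *\<^sub>C y) = H y0 a *\<^sub>C L y" if "cinner y e = 0" for a y
        using H(2)[of y a] all[of y y0] y0 that by (cases "y = 0") (auto simp: L_zero)
    qed
  next
    case False
    then show thesis using that[of id] L_zero by fastforce
  qed
qed

lemma semilinear_lift: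
  assumes dim: "cdim_at_least 3 TYPE('a)"
  obtains k U where "k = id \<or> k = cnj" "\<And>x y. U (x + y) = U x + U y"
    "\<And>a x. U (a *\<^sub>C x) = k a *\<^sub>C U x" "\<And>x. T (ray x) = ray (U x)"
proof -
  obtain k where k: "k = id \<or> k = cnj"
    and Lk: "\<And>a y. cinner y e = 0 \<Longrightarrow> L (a *\<^sub>C y) = k a *\<^sub>C L y"
    using L_homogeneous[OF dim] by metis
  have k_alg: "k (a + b) = k a + k b" "k (a * b) = k a * k b" "cmod (k a) = cmod a" "k 0 = 0" for a b
    using k by auto
  have L_add: "L (y + z) = L y + L z" if y: "cinner y e = 0" and z: "cinner z e = 0" for y z
  proof (cases "y = 0")
    case False
    then show ?thesis
    proof (cases rule: cindep_or_multiple[of y z])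
      case 1
      then show ?thesis using L_add_cindep y z by blast
    next
      case (2 c)
      have "L y + L z = (k 1 + k c) *\<^sub>C L y"
        using Lk[OF y, of 1] Lk[OF y, of c] by (simp add: 2 cvec.scale_left_distrib)
      also have "\<dots> = L ((1 + c) *\<^sub>C y)"
        by (simp add: Lk[OF y] k_alg)
      finally show ?thesis by (simp add: 2 cvec.scale_left_distrib)
    qed
  qed (simp add: L_zero)
  define A where "A x = cinner x e / cinner e e" for x
  define M where "M x = x - A x *\<^sub>C e" for x
  define U where "U x = k (A x) *\<^sub>C e' + L (M x)" for x
  have x: "x = A x *\<^sub>C e + M x" for x by (simp add: M_def)
  have M: "cinner (M x) e = 0" for x
    using e by (simp add: M_def A_def cinner_diff_left cinner_scaleC_left)
  have A_add: "A (x + y) = A x + A y" and A_scale: "A (a *\<^sub>C x) = a * A x" for x y a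
    by (simp_all add: A_def cinner_add_left cinner_scaleC_left add_divide_distrib)
  have M_add: "M (x + y) = M x + M y" and M_scale: "M (a *\<^sub>C x) = a *\<^sub>C M x" for x y a
    by (simp_all add: M_def A_add A_scale algebra_simps)
  show thesis
  proof (rule that[OF k])
    show "U (x + y) = U x + U y" for x y
      by (simp add: U_def A_add M_add L_add M k_alg algebra_simps)
    show "U (a *\<^sub>C x) = k a *\<^sub>C U x" for a x
      by (simp add: U_def A_scale M_scale Lk M k_alg algebra_simps)
    show "T (ray x) = ray (U x)" for x
    proof (cases "A x = 0")
      case True
      then show ?thesis using L[OF M, of x] by (simp add: U_def M_def k_alg)
    next
      case False
      \<comment> \<open>Up to a scalar, \<open>x\<close> lies in the affine hyperplane where the normalisation of \<open>L\<close> applies.\<close>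
      define n where "n = inverse (A x) *\<^sub>C M x"
      have n: "cinner n e = 0" by (simp add: n_def M cinner_scaleC_left)
      have Mn: "M x = A x *\<^sub>C n" using False by (simp add: n_def)
      have "x = A x *\<^sub>C (e + n)"
        using x[of x] by (simp add: Mn cvec.scale_right_distrib)
      moreover have "U x = k (A x) *\<^sub>C (e' + L n)"
        by (simp add: U_def Mn Lk n cvec.scale_right_distrib)
      ultimately show ?thesis
        using image_scale[OF L_anchor[OF n], of "k (A x)" "A x"] k_alg(3) by metis
    qed
  qed
qed

end

context ray_duality
begin

text \<open>For \<open>y \<noteq> 0\<close>, the image of \<open>e + y\<close> is represented by \<open>a *\<^sub>C e' + b *\<^sub>C v\<close> with coefficients of
modulus one; dividing by \<open>a\<close> yields the normalised representative \<open>(b / a) *\<^sub>C v\<close>.\<close>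
lemma exists_anchored:
  assumes e: "e \<noteq> 0"
  obtains e' L where "anchored_ray_duality T S e e' L"
proof -
  obtain e' where e': "T (ray e) = ray e'" by (rule T_ray_ex)
  have "\<exists>u. T (ray y) = ray u \<and> T (ray (e + y)) = ray (e' + u)" if y: "cinner y e = 0" for y
  proof (cases "y = 0")
    case True
    obtain u where "T (ray 0) = ray u" by (rule T_ray_ex)
    then have "T (ray 0) = ray 0" using T_zero by blast
    then show ?thesis using True e' by (intro exI[of _ 0]) auto
  next
    case False
    obtain v where v: "T (ray y) = ray v" by (rule T_ray_ex)
    obtain t where t: "T (ray (e + y)) = ray t" by (rule T_ray_ex)
    have "cindep e y"
      using e
    proof (cases rule: cindep_or_multiple[of e y])
      case (2 c)
      then show ?thesis using y e False by (simp add: cinner_scaleC_left)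
    qed
    then obtain a b where ab: "t = a *\<^sub>C e' + b *\<^sub>C v" "cmod a = 1" "cmod b = 1"
      by (rule image_combination[OF e' v, of 1 1 t]) (use t in auto)
    have "a \<noteq> 0" using ab by auto
    then have "t = a *\<^sub>C (e' + (b / a) *\<^sub>C v)" by (simp add: ab cvec.scale_right_distrib)
    then have "ray t = ray (e' + (b / a) *\<^sub>C v)" using ray_phase ab by metis
    moreover have "ray ((b / a) *\<^sub>C v) = ray v"
      using ab by (intro ray_phase) (simp add: norm_divide)
    ultimately show ?thesis using v t by metis
  qed
  then obtain L where "\<And>y. cinner y e = 0 \<Longrightarrow> T (ray y) = ray (L y) \<and> T (ray (e + y)) = ray (e' + L y)"
    by metis
  then have "anchored_ray_duality T S e e' L"
    using e e' by unfold_locales auto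
  then show thesis by (rule that)
qed

text \<open>For fixed \<open>y\<close> with \<open>S\<close>-representative \<open>v\<close>, the semilinear functional \<open>\<lambda>x. cinner (U x) v\<close> has
the same kernel as \<open>\<lambda>x. k (cinner x y)\<close>, so it is a multiple of the latter, by a scalar of
modulus one. Absorbing that scalar into \<open>v\<close> makes the pairing exact.\<close>
lemma dual_lift:
  assumes k: "k = id \<or> k = cnj" and U_add: "\<And>x y. U (x + y) = U x + U y"
    and U_scale: "\<And>a x. U (a *\<^sub>C x) = k a *\<^sub>C U x" and U: "\<And>x. T (ray x) = ray (U x)"
  obtains V where "\<And>y. S (ray y) = ray (V y)" "\<And>x y. cinner (U x) (V y) = k (cinner x y)"
proof -
  have "\<exists>v. S (ray y) = ray v \<and> (\<forall>x. cinner (U x) v = k (cinner x y))" for y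
  proof -
    obtain v where v: "S (ray y) = ray v" by (rule S_ray_ex)
    show ?thesis
    proof (cases "y = 0")
      case True
      have "cinner (U x) v = 0" for x
        using orthogonality[OF U v] True by simp
      then show ?thesis using v k True by auto
    next
      case False
      define c where "c = cinner (U y) v / cinner y y"
      have "cmod (cinner (U y) v) = cmod (cinner y y)" by (rule modulus[OF U v])
      then have c: "cmod c = 1" using False by (simp add: c_def norm_divide)
      have "cinner (U x) (c *\<^sub>C v) = k (cinner x y)" for x
      proof -
        obtain a p where x: "x = a *\<^sub>C y + p" and p: "cinner p y = 0"
          by (rule orthogonal_decomposition)
        have "cinner (U p) v = 0" using orthogonality[OF U v] p by simp
        then have "cinner (U x) (c *\<^sub>C v) = k a * (c * cnj c) * cinner y y"
          using False by (simp add: x U_add U_scale cinner_add_left cinner_scaleC_left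
            cinner_scaleC_right c_def)
        also have "c * cnj c = 1" using complex_norm_square[of c] c by simp
        also have "k a * 1 * cinner y y = k (cinner x y)"
          using k p by (auto simp: x cinner_add_left cinner_scaleC_left cinner_self)
        finally show ?thesis .
      qed
      then show ?thesis using v ray_phase[OF c, of v] by metis
    qed
  qed
  then show thesis using that by metis
qed

end

section \<open>Boundedness, inverses and adjoints\<close>

text \<open>The values of \<open>V\<close> on the unit ball are weakly bounded: pairing them with \<open>z\<close> is pairing unit
ball vectors with \<open>inv U z\<close>. The hypothesis is symmetric enough to be applied as well to the
pairs \<open>(V, U)\<close>, \<open>(inv U, inv V)\<close> and \<open>(inv V, inv U)\<close>.\<close>
lemma biadjoint_pair_bounded:
  fixes U V :: "'a::chilbert_space \<Rightarrow> 'a"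
  assumes k: "k = id \<or> k = cnj" and surj: "surj U"
    and adj: "\<And>x y. cinner (U x) (V y) = k (cinner x y)"
  obtains K where "\<And>y. norm y \<le> 1 \<Longrightarrow> norm (V y) \<le> K"
proof -
  have k_norm: "cmod (k a) = cmod a" for a using k by auto
  have "cmod (cinner z v) \<le> norm (inv U z)" if v: "v \<in> V ` cball 0 1" for z v
  proof -
    obtain y where y: "v = V y" "norm y \<le> 1" using v by auto
    have "cinner z v = k (cinner (inv U z) y)"
      by (metis adj surj surj_f_inv_f y(1))
    then have "cmod (cinner z v) \<le> norm (inv U z) * norm y"
      by (simp add: k_norm cinner_Cauchy_Schwarz)
    also have "\<dots> \<le> norm (inv U z)" using y(2) by (simp add: mult_left_le)
    finally show ?thesis .
  qed
  then obtain K where "\<And>v. v \<in> V ` cball 0 1 \<Longrightarrow> norm v \<le> K"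
    using weakly_bounded_imp_bounded[of "V ` cball 0 1" "\<lambda>z. norm (inv U z)"] by metis
  then show thesis by (intro that[of K]) simp
qed

lemma semilinear_bounded_linear:
  fixes U :: "'a::complex_inner \<Rightarrow> 'a"
  assumes k: "k = id \<or> k = cnj" and add: "\<And>x y. U (x + y) = U x + U y"
    and scale: "\<And>a x. U (a *\<^sub>C x) = k a *\<^sub>C U x" and bd: "\<And>x. norm x \<le> 1 \<Longrightarrow> norm (U x) \<le> K"
  shows "bounded_linear U"
proof (rule bounded_linear_intro[where K = K])
  show scaleR: "U (r *\<^sub>R x) = r *\<^sub>R U x" for r x
    using scale[of "complex_of_real r" x] k by (auto simp: scaleC_of_real)
  show "norm (U x) \<le> norm x * K" for x
  proof (cases "x = 0")
    case True
    then show ?thesis using scaleR[of 0 x] by simp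
  next
    case False
    have "U x = norm x *\<^sub>R U (inverse (norm x) *\<^sub>R x)"
      using False by (simp flip: scaleR)
    moreover have "norm (U (inverse (norm x) *\<^sub>R x)) \<le> K"
      using False by (intro bd) simp
    ultimately show ?thesis by (metis abs_norm_cancel mult_left_mono norm_ge_zero norm_scaleR)
  qed
qed (rule add)

lemma semilinear_inv:
  fixes U :: "'a::complex_inner \<Rightarrow> 'a"
  assumes "bij U" and add: "\<And>x y. U (x + y) = U x + U y"
    and scale: "\<And>a x. U (a *\<^sub>C x) = k a *\<^sub>C U x" and k: "k = id \<or> k = cnj"
  shows "inv U (x + y) = inv U x + inv U y" "inv U (a *\<^sub>C x) = k a *\<^sub>C inv U x"
proof -
  have *: "U (inv U x) = x" "inv U (U x) = x" for x
    using \<open>bij U\<close> by (simp_all add: bij_is_surj bij_is_inj surj_f_inv_f)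
  show "inv U (x + y) = inv U x + inv U y"
    by (metis * add)
  have "U (k a *\<^sub>C inv U x) = a *\<^sub>C x"
    using k by (auto simp: scale *)
  then show "inv U (a *\<^sub>C x) = k a *\<^sub>C inv U x"
    by (metis *(2))
qed


theorem mainTheorem1:
  fixes T S :: "'a::chilbert_space set \<Rightarrow> 'a set"
  assumes "cdim_at_least 3 TYPE('a)"
    and "bij_betw T rays rays"
    and "bij_betw S rays rays"
    and "\<And>X Y. X \<in> rays \<Longrightarrow> Y \<in> rays \<Longrightarrow> ray_prod (T X) (S Y) = ray_prod X Y"
  shows "\<exists>U V :: 'a \<Rightarrow> 'a.
      (bounded_clinear U \<and> bounded_clinear V \<and> V = inv (cadjoint U) \<or>
       bounded_antilinear U \<and> bounded_antilinear V \<and> V = inv (antilinear_adjoint U)) \<and>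
      boundedly_invertible U \<and> boundedly_invertible V \<and>
      (\<forall>x. T (ray x) = ray (U x) \<and> S (ray x) = ray (V x))"
proof -
  interpret ray_duality T S
    using assms(2-4) by unfold_locales
  obtain e :: 'a where e: "e \<noteq> 0"
  proof -
    obtain B :: "'a set" where "finite B" "card B = 3" "\<not> cvec.dependent B"
      using assms(1) by (auto simp: cdim_at_least_def)
    then show thesis using that cvec.dependent_zero by (metis card_gt_0_iff ex_in_conv zero_less_numeral)
  qed
  obtain e' L where "anchored_ray_duality T S e e' L"
    by (rule exists_anchored[OF e])
  then obtain k U where k: "k = id \<or> k = cnj" and U_add: "\<And>x y. U (x + y) = U x + U y"
    and U_scale: "\<And>a x. U (a *\<^sub>C x) = k a *\<^sub>C U x" and U: "\<And>x. T (ray x) = ray (U x)"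
    using anchored_ray_duality.semilinear_lift[OF _ assms(1)] by metis
  obtain V where V: "\<And>y. S (ray y) = ray (V y)" and adj: "\<And>x y. cinner (U x) (V y) = k (cinner x y)"
    using dual_lift[OF k U_add U_scale U] by blast
  have kk: "k (k a) = a" "cmod (k a) = cmod a" "k (a + b) = k a + k b" "k (a * b) = k a * k b"
    "k (cnj a) = cnj (k a)" "k a = 0 \<longleftrightarrow> a = 0" for a b
    using k by auto
  have surj_U: "surj U"
  proof (unfold surj_def, rule allI)
    fix z
    obtain x where "T (ray x) = ray z" by (rule T_ray_onto)
    then obtain c where "z = c *\<^sub>C U x" using U by (metis ray_eqD)
    then have "z = U (k c *\<^sub>C x)" by (simp add: U_scale kk)
    then show "\<exists>x. z = U x" ..
  qed
  \<comment> \<open>As \<open>U\<close> is onto, its pairing with \<open>V y\<close> determines \<open>V y\<close>; this makes \<open>V\<close> semilinear.\<close>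
  have V_ext: "v = V y" if "\<And>x. cinner (U x) v = k (cinner x y)" for v y
    using that surj_U adj by (intro cinner_ext) (metis surjD)
  have V_add: "V (x + y) = V x + V y" for x y
    by (rule V_ext[symmetric]) (simp add: cinner_add_right adj kk)
  have V_scale: "V (a *\<^sub>C x) = k a *\<^sub>C V x" for a x
    by (rule V_ext[symmetric]) (simp add: cinner_scaleC_right adj kk)
  have surj_V: "surj V"
  proof (unfold surj_def, rule allI)
    fix z
    obtain x where "S (ray x) = ray z" by (rule S_ray_onto)
    then obtain c where "z = c *\<^sub>C V x" using V by (metis ray_eqD)
    then have "z = V (k c *\<^sub>C x)" by (simp add: V_scale kk)
    then show "\<exists>x. z = V x" ..
  qed
  have adj': "cinner (V y) (U x) = k (cinner y x)" for x y
    using adj[of x y] by (metis cinner_commute kk(5))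
  have inj_U: "inj U"
  proof (rule injI)
    fix x y assume "U x = U y"
    then have "cnj (k (cinner x z)) = cnj (k (cinner y z))" for z using adj by metis
    then have "cinner z x = cinner z y" for z
      using kk(1) by (metis cinner_commute complex_cnj_cnj)
    then show "x = y" by (rule cinner_ext)
  qed
  have inj_V: "inj V"
  proof (rule injI)
    fix x y assume "V x = V y"
    then have "cinner z x = cinner z y" for z
      using kk(1) adj by metis
    then show "x = y" by (rule cinner_ext)
  qed
  have bij: "bij U" "bij V"
    using inj_U inj_V surj_U surj_V by (auto simp: bij_def)
  have inv: "U (inv U x) = x" "V (inv V x) = x" for x
    using surj_U surj_V by (simp_all add: surj_f_inv_f)
  have adj_inv: "cinner (inv V x) (inv U y) = k (cinner x y)"
    "cinner (inv U y) (inv V x) = k (cinner y x)" for x y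
    using adj[of "inv U y" "inv V x"] adj'[of "inv V x" "inv U y"] by (simp_all add: inv kk)
  have bl: "bounded_linear U" "bounded_linear V"
    using biadjoint_pair_bounded[OF k surj_V adj'] semilinear_bounded_linear[OF k U_add U_scale]
      biadjoint_pair_bounded[OF k surj_U adj] semilinear_bounded_linear[OF k V_add V_scale]
    by metis+
  have surj_inv: "surj (inv U)" "surj (inv V)"
    using bij by (simp_all add: bij_imp_bij_inv bij_is_surj)
  have bl_inv: "bounded_linear (inv U)" "bounded_linear (inv V)"
    using biadjoint_pair_bounded[OF k surj_inv(2) adj_inv(1)]
      semilinear_bounded_linear[OF k semilinear_inv[OF bij(1) U_add U_scale k]]
      biadjoint_pair_bounded[OF k surj_inv(1) adj_inv(2)]
      semilinear_bounded_linear[OF k semilinear_inv[OF bij(2) V_add V_scale k]]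
    by metis+
  \<comment> \<open>The pairing identity with \<open>inv V y\<close> in place of \<open>y\<close> says that \<open>inv V\<close> is the adjoint of \<open>U\<close>.\<close>
  have adjoint: "cinner (U x) y = k (cinner x (inv V y))" for x y
    using adj[of x "inv V y"] by (simp add: inv)
  have adjoint_unique: "W = inv V" if "\<And>x y. cinner (U x) y = k (cinner x (W y))" for W
  proof
    fix y
    have "cinner x (W y) = cinner x (inv V y)" for x
      using that[of x y] adjoint[of x y] by (metis kk(1))
    then show "W y = inv V y" by (rule cinner_ext)
  qed
  have inv_scale: "inv V (a *\<^sub>C x) = k a *\<^sub>C inv V x" for a x
    by (rule semilinear_inv(2)[OF bij(2) V_add V_scale k])
  have inv_inv: "inv (inv V) = V" using bij(2) by (rule inv_inv_eq)
  from k have "bounded_clinear U \<and> bounded_clinear V \<and> V = inv (cadjoint U) \<or>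
       bounded_antilinear U \<and> bounded_antilinear V \<and> V = inv (antilinear_adjoint U)"
  proof
    assume k: "k = id"
    have "cadjoint U = inv V"
      unfolding cadjoint_def
    proof (rule the_equality)
      show "bounded_clinear (inv V) \<and> (\<forall>x y. cinner (U x) y = cinner x (inv V y))"
        using adjoint bl_inv(2) inv_scale by (simp add: k bounded_clinear_def)
      show "W = inv V" if "bounded_clinear W \<and> (\<forall>x y. cinner (U x) y = cinner x (W y))" for W
        using that by (intro adjoint_unique) (simp add: k)
    qed
    then show ?thesis
      using bl U_scale V_scale inv_inv by (simp add: k bounded_clinear_def)
  next
    assume k: "k = cnj"
    have "antilinear_adjoint U = inv V"
      unfolding antilinear_adjoint_def
    proof (rule the_equality)
      show "bounded_antilinear (inv V) \<and> (\<forall>x y. cinner (U x) y = cnj (cinner x (inv V y)))"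
        using adjoint bl_inv(2) inv_scale by (simp add: k bounded_antilinear_def)
      show "W = inv V" if "bounded_antilinear W \<and> (\<forall>x y. cinner (U x) y = cnj (cinner x (W y)))" for W
        using that by (intro adjoint_unique) (simp add: k)
    qed
    then show ?thesis
      using bl U_scale V_scale inv_inv by (simp add: k bounded_antilinear_def)
  qed
  moreover have "boundedly_invertible U" "boundedly_invertible V"
    using bij bl_inv by (auto simp: boundedly_invertible_def)
  ultimately show ?thesis using U V by blast
qed

end
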